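(* For all integers $n\geq 4$, we have $\mathrm{tc}_{5,2}(K_n) = 2$.
   Context: For integers $r\geq k\geq 1$, an $(r,k)$-colouring of a graph $G$ is a function $\varphi:E(G)\to\binom{[r]}{k}$, assigning to each edge a set of exactly $k$ colours from $[r]=\{1,\dots,r\}$. A subgraph $H\subseteq G$ is monochromatic if there is a colour $i$ belonging to $\varphi(e)$ for every $e\in E(H)$. For an $(r,k)$-colouring $\varphi$ of $G$, $\mathrm{tc}(G,\varphi)$ is the minimum number of monochromatic trees (not necessarily of the same colour; a single vertex counts as a tree) whose union covers $V(G)$. The tree cover number $\mathrm{tc}_{r,k}(G)$ is the minimum $m$ such that every $(r,k)$-colouring $\varphi$ of $E(G)$ satisfies $\mathrm{tc}(G,\varphi)\leq m$. *)

theory Defs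
  imports Main
begin

record 'a sgraph =
  verts :: "'a set"
  edges :: "'a set set"

definition simple_graph :: "'a sgraph \<Rightarrow> bool" where
  "simple_graph G \<longleftrightarrow> finite (verts G) \<and> (\<forall>e\<in>edges G. e \<subseteq> verts G \<and> card e = 2)"

definition subgraph :: "'a sgraph \<Rightarrow> 'a sgraph \<Rightarrow> bool" where
  "subgraph H G \<longleftrightarrow> simple_graph H \<and> verts H \<subseteq> verts G \<and> edges H \<subseteq> edges G"

definition complete_graph :: "nat \<Rightarrow> nat sgraph" where
  "complete_graph n = \<lparr>verts = {1..n}, edges = {e. e \<subseteq> {1..n} \<and> card e = 2}\<rparr>"

definition walk :: "'a sgraph \<Rightarrow> 'a list \<Rightarrow> bool" where
  "walk G p \<longleftrightarrow> p \<noteq> [] \<and> set p \<subseteq> verts G \<and> successively (\<lambda>u v. {u, v} \<in> edges G) p"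

definition connected_graph :: "'a sgraph \<Rightarrow> bool" where
  "connected_graph G \<longleftrightarrow> verts G \<noteq> {} \<and>
     (\<forall>u\<in>verts G. \<forall>v\<in>verts G. \<exists>p. walk G p \<and> hd p = u \<and> last p = v)"

text \<open>A cycle is the list of its vertices, without repetition of the starting vertex.\<close>

definition cycle :: "'a sgraph \<Rightarrow> 'a list \<Rightarrow> bool" where
  "cycle G p \<longleftrightarrow> walk G p \<and> distinct p \<and> 3 \<le> length p \<and> {last p, hd p} \<in> edges G"

definition tree :: "'a sgraph \<Rightarrow> bool" where
  "tree T \<longleftrightarrow> simple_graph T \<and> connected_graph T \<and> (\<nexists>p. cycle T p)"

text \<open>Only the values of \<open>\<phi>\<close> on the edges of \<open>G\<close> matter.\<close>

definition colouring :: "nat \<Rightarrow> nat \<Rightarrow> 'a sgraph \<Rightarrow> ('a set \<Rightarrow> nat set) \<Rightarrow> bool" where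
  "colouring r k G \<phi> \<longleftrightarrow> (\<forall>e\<in>edges G. \<phi> e \<subseteq> {1..r} \<and> card (\<phi> e) = k)"

definition monochromatic :: "nat \<Rightarrow> ('a set \<Rightarrow> nat set) \<Rightarrow> 'a sgraph \<Rightarrow> bool" where
  "monochromatic r \<phi> H \<longleftrightarrow> (\<exists>i\<in>{1..r}. \<forall>e\<in>edges H. i \<in> \<phi> e)"

definition mono_tree_cover ::
  "nat \<Rightarrow> 'a sgraph \<Rightarrow> ('a set \<Rightarrow> nat set) \<Rightarrow> 'a sgraph set \<Rightarrow> bool" where
  "mono_tree_cover r G \<phi> \<T> \<longleftrightarrow> finite \<T> \<and>
     (\<forall>T\<in>\<T>. subgraph T G \<and> tree T \<and> monochromatic r \<phi> T) \<and>
     (\<Union>T\<in>\<T>. verts T) = verts G"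

definition tc :: "nat \<Rightarrow> 'a sgraph \<Rightarrow> ('a set \<Rightarrow> nat set) \<Rightarrow> nat" where
  "tc r G \<phi> = (LEAST m. \<exists>\<T>. mono_tree_cover r G \<phi> \<T> \<and> card \<T> = m)"

definition tree_cover_number :: "nat \<Rightarrow> nat \<Rightarrow> 'a sgraph \<Rightarrow> nat" where
  "tree_cover_number r k G = (LEAST m. \<forall>\<phi>. colouring r k G \<phi> \<longrightarrow> tc r G \<phi> \<le> m)"

text \<open>Both minima are over nonempty sets when \<open>G\<close> is finite and \<open>r \<ge> 1\<close>: the
  single vertices form a cover.\<close>

lemma singletons_cover:
  assumes "finite (verts G)" "1 \<le> r"
  defines "\<T> \<equiv> (\<lambda>v. \<lparr>verts = {v}, edges = {}\<rparr>) ` verts G"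
  shows "mono_tree_cover r G \<phi> \<T>" "card \<T> = card (verts G)"
proof -
  have t: "tree \<lparr>verts = {v}, edges = {}\<rparr>" for v :: 'a
    by (auto simp: tree_def simple_graph_def connected_graph_def cycle_def walk_def
        intro!: exI[of _ "[v]"])
  show "mono_tree_cover r G \<phi> \<T>"
    using assms t
    by (auto simp: mono_tree_cover_def subgraph_def simple_graph_def monochromatic_def)
  show "card \<T> = card (verts G)"
    unfolding \<T>_def by (rule card_image) (auto simp: inj_on_def)
qed

lemma tc_attained:
  assumes "finite (verts G)" "1 \<le> r"
  shows "\<exists>\<T>. mono_tree_cover r G \<phi> \<T> \<and> card \<T> = tc r G \<phi>"
  unfolding tc_def by (rule LeastI_ex) (use singletons_cover[OF assms] in blast)

lemma tc_le_card_verts: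
  assumes "finite (verts G)" "1 \<le> r"
  shows "tc r G \<phi> \<le> card (verts G)"
  unfolding tc_def by (rule Least_le) (use singletons_cover[OF assms] in blast)

lemma tree_cover_number_attained:
  assumes "finite (verts G)" "1 \<le> r" "colouring r k G \<phi>"
  shows "tc r G \<phi> \<le> tree_cover_number r k G"
proof -
  have "\<forall>\<phi>. colouring r k G \<phi> \<longrightarrow> tc r G \<phi> \<le> tree_cover_number r k G"
    unfolding tree_cover_number_def
    by (rule LeastI_ex) (use tc_le_card_verts[OF assms(1,2)] in blast)
  then show ?thesis using assms(3) by blast
qed

end

theory Submission
  imports Defs
begin

text \<open>Record for every vertex the five monochromatic components containing it. Adjacent
  vertices share at least two of them. Choose \<open>u\<close>, \<open>v\<close> sharing the least number \<open>m \<ge> 2\<close> of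
  components, and pick two shared ones. A vertex \<open>z\<close> outside both would agree with \<open>u\<close> and with
  \<open>v\<close> in at least \<open>m\<close> of the three other colours, hence \<open>u\<close> and \<open>v\<close> would agree in at least
  \<open>2 m - 3\<close> of these; but they agree in \<open>m - 2\<close> of them. So the two components cover everything.
  One tree is not enough when colour \<open>i \<le> 4\<close> avoids all edges at vertex \<open>i\<close> and colour 5 is
  not used.\<close>

section \<open>Vertices agreeing in many labels\<close>

text \<open>Components enter only as labels: \<open>f v i\<close> will be the component of
  \<open>v\<close> in colour \<open>i\<close>, and \<open>t\<close> the number of colours on an
  edge. The bound on \<open>card I\<close> is what the count by inclusion and exclusion needs when
  \<open>s\<close> shared labels are picked instead of two.\<close>

lemma agreement_cover:
  fixes f :: "'v \<Rightarrow> 'i \<Rightarrow> 'c"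
  assumes I: "finite I" and X: "X \<noteq> {}"
    and agree: "\<And>u v. u \<in> X \<Longrightarrow> v \<in> X \<Longrightarrow> t \<le> card {i\<in>I. f u i = f v i}"
    and st: "s \<le> t" "card I < t + 2 * s"
  obtains u S where "u \<in> X" "S \<subseteq> I" "card S = s" "\<And>v. v \<in> X \<Longrightarrow> \<exists>i\<in>S. f v i = f u i"
proof -
  define A where "A u v = {i\<in>I. f u i = f v i}" for u v
  have finA: "finite (A u v)" for u v using I by (simp add: A_def)
  obtain p where p: "p \<in> X \<times> X"
    and pmin: "\<And>q. q \<in> X \<times> X \<Longrightarrow> card (A (fst p) (snd p)) \<le> card (A (fst q) (snd q))"
    using X exists_least_iff[of "\<lambda>m. \<exists>q\<in>X \<times> X. card (A (fst q) (snd q)) = m"]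
    by (metis (no_types, lifting) SigmaI ex_in_conv not_le_imp_less)
  define u v m where "u = fst p" and "v = snd p" and "m = card (A u v)"
  have uv: "u \<in> X" "v \<in> X" using p by (auto simp: u_def v_def)
  have min: "m \<le> card (A a b)" if "a \<in> X" "b \<in> X" for a b
    using pmin[of "(a, b)"] that by (simp add: u_def v_def m_def)
  have tm: "t \<le> m" using agree[OF uv] by (simp add: m_def A_def)
  then obtain S where S: "S \<subseteq> A u v" "card S = s"
    using st(1) obtain_subset_with_card_n[of s "A u v"] unfolding m_def by (metis order_trans)
  have SI: "S \<subseteq> I" using S by (auto simp: A_def)
  have finS: "finite S" using SI I finite_subset by blast
  have "\<exists>i\<in>S. f z i = f u i" if z: "z \<in> X" for z
  proof (rule ccontr)
    assume no: "\<not> ?thesis"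
    \<comment> \<open>On \<open>S\<close> the labels of \<open>u\<close> and \<open>v\<close>
      coincide, so \<open>z\<close>, which misses those of \<open>u\<close>, misses those of
      \<open>v\<close> too.\<close>
    have sub: "A z u \<union> A z v \<subseteq> I - S"
    proof -
      have "f u i = f v i" if "i \<in> S" for i using S(1) that by (auto simp: A_def)
      then show ?thesis using no by (auto simp: A_def)
    qed
    have "card (A z u \<union> A z v) \<le> card I - s"
      using card_mono[OF _ sub] I SI finS S(2) by (simp add: card_Diff_subset)
    moreover have "card (A z u \<inter> A z v) \<le> m - s"
    proof -
      have "A z u \<inter> A z v \<subseteq> A u v - S" using sub by (auto simp: A_def)
      then have "card (A z u \<inter> A z v) \<le> card (A u v - S)"
        using finA by (intro card_mono) auto
      then show ?thesis using S finS by (simp add: card_Diff_subset m_def)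
    qed
    moreover have "card (A z u) + card (A z v) = card (A z u \<union> A z v) + card (A z u \<inter> A z v)"
      using finA by (intro card_Un_Int)
    moreover have "s \<le> card I" using card_mono[OF I SI] S(2) by simp
    \<comment> \<open>The sum of the two agreements is at least \<open>2 * m\<close> and at most
      \<open>(card I - s) + (m - s)\<close>. Neither subtraction truncates, so
      \<open>m + 2 * s\<close> \<le> \<open>card I\<close> < \<open>t + 2 * s\<close>, against
      \<open>t\<close> \<le> \<open>m\<close>.\<close>
    ultimately show False using min[OF z uv(1)] min[OF z uv(2)] st tm by linarith
  qed
  with that uv(1) SI S(2) show ?thesis by blast
qed

section \<open>Spanning trees of components\<close>

lemma walk_mono:
  assumes "walk G p" "verts G \<subseteq> verts H" "edges G \<subseteq> edges H"
  shows "walk H p"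
  using assms successively_mono[of _ p "\<lambda>u v. {u, v} \<in> edges H"] unfolding walk_def by blast

text \<open>The vertices next to \<open>w\<close> on the cycle serve; they differ because a cycle
  has length at least 3. This keeps leaves off cycles.\<close>

lemma cycle_two_neighbours:
  assumes "cycle G p" "w \<in> set p"
  obtains x y where "x \<noteq> y" "{w, x} \<in> edges G" "{w, y} \<in> edges G"
proof -
  let ?n = "length p"
  have d: "distinct p" and n: "3 \<le> ?n" and cl: "{last p, hd p} \<in> edges G"
    and wk: "\<And>i. Suc i < ?n \<Longrightarrow> {p ! i, p ! Suc i} \<in> edges G"
    using assms(1) by (auto simp: cycle_def walk_def successively_conv_nth)
  have ne: "p \<noteq> []" using n by auto
  have cl': "{p ! (?n - 1), p ! 0} \<in> edges G"
    using cl ne by (simp add: last_conv_nth hd_conv_nth)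
  obtain k where k: "k < ?n" "p ! k = w" using assms(2) by (auto simp: in_set_conv_nth)
  \<comment> \<open>Cyclic successor and predecessor of the index \<open>k\<close>.\<close>
  define a where "a = (if Suc k < ?n then Suc k else 0)"
  define b where "b = (if k = 0 then ?n - 1 else k - 1)"
  have ab: "a < ?n" "b < ?n" "a \<noteq> b" using k n by (auto simp: a_def b_def)
  have "{w, p ! a} \<in> edges G"
  proof (cases "Suc k < ?n")
    case False
    then have "k = ?n - 1" using k by simp
    then show ?thesis using cl' k False by (simp add: a_def)
  qed (use wk[of k] k in \<open>simp add: a_def\<close>)
  moreover have "{w, p ! b} \<in> edges G"
  proof (cases k)
    case 0
    then show ?thesis using cl' k by (simp add: b_def insert_commute)
  qed (use wk[of "k - 1"] k in \<open>simp add: b_def insert_commute\<close>)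
  moreover have "p ! a \<noteq> p ! b" using ab d by (simp add: nth_eq_iff_index_eq)
  ultimately show ?thesis using that by blast
qed

text \<open>The only neighbour of \<open>w\<close> is \<open>v\<close>, so no cycle passes through
  \<open>w\<close>, and a cycle avoiding \<open>w\<close> would already lie in
  \<open>T\<close>.\<close>

lemma tree_add_leaf:
  assumes T: "tree T" and v: "v \<in> verts T" and w: "w \<notin> verts T"
  shows "tree \<lparr>verts = insert w (verts T), edges = insert {v, w} (edges T)\<rparr>" (is "tree ?T")
proof -
  have sT: "simple_graph T" and cT: "connected_graph T" and aT: "\<And>p. \<not> cycle T p"
    using T by (auto simp: tree_def)
  have nw: "x = v" if "{w, x} \<in> edges ?T" for x
    using that sT v w by (auto simp: simple_graph_def doubleton_eq_iff)
  have "simple_graph ?T"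
    using sT v w by (auto simp: simple_graph_def card_2_iff)
  moreover have "connected_graph ?T"
  proof -
    have old: "\<exists>p. walk ?T p \<and> hd p = x \<and> last p = y" if "x \<in> verts T" "y \<in> verts T" for x y
      using cT that walk_mono[of T _ ?T] unfolding connected_graph_def
      by (metis select_convs(1) select_convs(2) subset_insertI)
    have fw: "\<exists>p. walk ?T p \<and> hd p = w \<and> last p = y" if y: "y \<in> verts T" for y
    proof -
      obtain p where "walk ?T p" "hd p = v" "last p = y" using old[OF v y] by blast
      then have "walk ?T (w # p) \<and> hd (w # p) = w \<and> last (w # p) = y"
        by (auto simp: walk_def successively_Cons insert_commute)
      then show ?thesis by blast
    qed
    have bw: "\<exists>p. walk ?T p \<and> hd p = x \<and> last p = w" if x: "x \<in> verts T" for x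
    proof -
      obtain p where "walk ?T p" "hd p = x" "last p = v" using old[OF x v] by blast
      then have "walk ?T (p @ [w]) \<and> hd (p @ [w]) = x \<and> last (p @ [w]) = w"
        by (auto simp: walk_def successively_append_iff)
      then show ?thesis by blast
    qed
    have "walk ?T [w]" by (simp add: walk_def)
    then have "\<exists>p. walk ?T p \<and> hd p = w \<and> last p = w" by (metis last.simps list.sel(1))
    then show ?thesis unfolding connected_graph_def using old fw bw by auto
  qed
  moreover have "\<not> cycle ?T p" for p
  proof
    assume c: "cycle ?T p"
    have wp: "w \<notin> set p" using cycle_two_neighbours[OF c] nw by metis
    have e: "{x, y} \<in> edges T" if "{x, y} \<in> edges ?T" "x \<in> set p" "y \<in> set p" for x y
      using that wp by (auto simp: doubleton_eq_iff)
    have "p \<noteq> []" using c by (auto simp: cycle_def)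
    then have "{last p, hd p} \<in> edges T" using c by (intro e) (auto simp: cycle_def)
    moreover have "successively (\<lambda>x y. {x, y} \<in> edges T) p"
      unfolding successively_conv_nth
    proof (intro allI impI e)
      fix i assume "Suc i < length p"
      then show "{p ! i, p ! Suc i} \<in> edges ?T"
        using c unfolding cycle_def walk_def successively_conv_nth by blast
    qed auto
    moreover have "set p \<subseteq> verts T" using c wp by (auto simp: cycle_def walk_def)
    ultimately have "cycle T p" using c by (simp add: cycle_def walk_def)
    then show False using aT by blast
  qed
  ultimately show ?thesis by (simp add: tree_def)
qed

text \<open>As a relation, so that components are images of single vertices under the reflexive
  transitive closure.\<close>

definition adj :: "'a sgraph \<Rightarrow> ('a \<times> 'a) set" where
  "adj G = {(x, y). {x, y} \<in> edges G}"

text \<open>A largest tree among those that contain \<open>u\<close> and stay in its component spans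
  the component: an edge leaving it would allow one more leaf.\<close>

lemma component_spanning_tree:
  assumes G: "simple_graph G" and u: "u \<in> verts G"
  obtains T where "subgraph T G" "tree T" "verts T = (adj G)\<^sup>* `` {u}"
proof -
  let ?C = "(adj G)\<^sup>* `` {u}"
  define P where "P T \<longleftrightarrow> subgraph T G \<and> tree T \<and> u \<in> verts T \<and> verts T \<subseteq> ?C" for T
  have fin: "finite (verts G)" using G by (simp add: simple_graph_def)
  have bound: "card (verts T) \<le> card (verts G)" if "P T" for T
    using that fin by (auto simp: P_def subgraph_def intro: card_mono)
  have "P \<lparr>verts = {u}, edges = {}\<rparr>"
    using u by (auto simp: P_def subgraph_def tree_def simple_graph_def connected_graph_def
        cycle_def walk_def intro!: exI[of _ "[u]"])
  then obtain T where T: "P T" and max: "\<And>T'. P T' \<Longrightarrow> card (verts T') \<le> card (verts T)"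
    using ex_has_greatest_nat[of P _ "\<lambda>T. card (verts T)" "Suc (card (verts G))"] bound
    by (metis le_imp_less_Suc)
  have closed: "y \<in> verts T" if x: "x \<in> verts T" and xy: "(x, y) \<in> adj G" for x y
  proof (rule ccontr)
    assume y: "y \<notin> verts T"
    let ?T = "\<lparr>verts = insert y (verts T), edges = insert {x, y} (edges T)\<rparr>"
    have tT: "tree ?T" using tree_add_leaf[OF _ x y] T by (simp add: P_def)
    have "y \<in> ?C" using T x xy by (auto simp: P_def intro: rtrancl_into_rtrancl)
    moreover have "{x, y} \<in> edges G" using xy by (simp add: adj_def)
    moreover have "y \<in> verts G" using \<open>{x, y} \<in> edges G\<close> G by (auto simp: simple_graph_def)
    ultimately have "P ?T" using T tT by (auto simp: P_def subgraph_def tree_def)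
    moreover have "finite (verts T)" using T by (simp add: P_def subgraph_def simple_graph_def)
    ultimately show False using max[of ?T] y by simp
  qed
  have "y \<in> verts T" if "(u, y) \<in> (adj G)\<^sup>*" for y
    using that by (induction rule: rtrancl_induct) (use T closed in \<open>auto simp: P_def\<close>)
  then have "verts T = ?C" using T by (auto simp: P_def)
  with that T show ?thesis by (auto simp: P_def)
qed

section \<open>Upper bound\<close>

definition colour_class :: "('a set \<Rightarrow> nat set) \<Rightarrow> 'a sgraph \<Rightarrow> nat \<Rightarrow> 'a sgraph" where
  "colour_class \<phi> G i = \<lparr>verts = verts G, edges = {e \<in> edges G. i \<in> \<phi> e}\<rparr>"

lemma component_eq_if_adj:
  assumes "(x, y) \<in> adj G"
  shows "(adj G)\<^sup>* `` {x} = (adj G)\<^sup>* `` {y}"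
proof -
  have "(y, x) \<in> adj G" using assms by (simp add: adj_def insert_commute)
  with assms show ?thesis by (auto intro: converse_rtrancl_into_rtrancl)
qed

text \<open>The ends of an edge lie in the same component for each of its \<open>k\<close> colours,
  so \<open>agreement_cover\<close> applies with \<open>t = k\<close>. The resulting trees span the
  components of one common vertex \<open>u\<close> in the \<open>s\<close> colours of
  \<open>S\<close>.\<close>

lemma tc_complete_graph_le:
  assumes col: "colouring r k (complete_graph n) \<phi>"
    and n: "1 \<le> n" and kr: "k \<le> r" and s: "s \<le> k" "r < k + 2 * s"
  shows "tc r (complete_graph n) \<phi> \<le> s"
proof -
  let ?G = "complete_graph n"
  define f where "f v i = (adj (colour_class \<phi> ?G i))\<^sup>* `` {v}" for v i
  have sG: "simple_graph (colour_class \<phi> ?G i)" for i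
    by (auto simp: simple_graph_def complete_graph_def colour_class_def)
  have agree: "k \<le> card {i\<in>{1..r}. f u i = f v i}" if "u \<in> {1..n}" "v \<in> {1..n}" for u v
  proof (cases "u = v")
    \<comment> \<open>No edge is available here; a vertex agrees with itself in all \<open>r\<close>
      colours, and \<open>k\<close> \<le> \<open>r\<close>.\<close>
    case True
    then have "{i\<in>{1..r}. f u i = f v i} = {1..r}" by auto
    then show ?thesis using kr by simp
  next
    case False
    then have e: "{u, v} \<in> edges ?G" using that by (auto simp: complete_graph_def)
    then have c: "\<phi> {u, v} \<subseteq> {1..r}" "card (\<phi> {u, v}) = k"
      using col by (auto simp: colouring_def)
    have "\<phi> {u, v} \<subseteq> {i\<in>{1..r}. f u i = f v i}"
    proof
      fix i assume i: "i \<in> \<phi> {u, v}"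
      then have "(u, v) \<in> adj (colour_class \<phi> ?G i)"
        using e by (simp add: adj_def colour_class_def)
      then have "f u i = f v i" unfolding f_def by (rule component_eq_if_adj)
      then show "i \<in> {i\<in>{1..r}. f u i = f v i}" using i c by auto
    qed
    then have "card (\<phi> {u, v}) \<le> card {i\<in>{1..r}. f u i = f v i}" by (intro card_mono) auto
    then show ?thesis using c by simp
  qed
  obtain u S where u: "u \<in> {1..n}" and S: "S \<subseteq> {1..r}" "card S = s"
    and cover: "\<And>v. v \<in> {1..n} \<Longrightarrow> \<exists>i\<in>S. f v i = f u i"
    using agreement_cover[of "{1..r}" "{1..n}" k f s] agree n s by auto
  have "\<exists>T. subgraph T (colour_class \<phi> ?G i) \<and> tree T \<and> verts T = f u i" for i
    using component_spanning_tree[OF sG, of u i] u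
    by (auto simp: f_def colour_class_def complete_graph_def)
  then obtain T where T: "\<And>i. subgraph (T i) (colour_class \<phi> ?G i)"
    "\<And>i. tree (T i)" "\<And>i. verts (T i) = f u i" by metis
  have finS: "finite S" using S finite_subset by blast
  have sub: "subgraph (T i) ?G" for i
    using T(1)[of i] by (auto simp: subgraph_def colour_class_def)
  have mono: "monochromatic r \<phi> (T i)" if "i \<in> S" for i
    using T(1)[of i] that S by (auto simp: monochromatic_def subgraph_def colour_class_def)
  have "v \<in> (\<Union>i\<in>S. verts (T i))" if v: "v \<in> verts ?G" for v
  proof -
    obtain i where "i \<in> S" "f v i = f u i" using cover v by (auto simp: complete_graph_def)
    moreover have "v \<in> f v i" by (simp add: f_def)
    ultimately show ?thesis using T(3) by auto
  qed
  moreover have "(\<Union>i\<in>S. verts (T i)) \<subseteq> verts ?G" using sub by (auto simp: subgraph_def)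
  ultimately have "mono_tree_cover r ?G \<phi> (T ` S)"
    using finS sub T(2) mono by (auto simp: mono_tree_cover_def)
  then have "tc r ?G \<phi> \<le> card (T ` S)" unfolding tc_def by (intro Least_le) blast
  \<comment> \<open>Only an inequality, since trees chosen for different colours may
    coincide.\<close>
  also have "\<dots> \<le> s" using card_image_le[OF finS] S(2) by simp
  finally show ?thesis .
qed

section \<open>Lower bound\<close>

lemma connected_graph_incident_edge:
  assumes "connected_graph G" "x \<in> verts G" "y \<in> verts G" "x \<noteq> y"
  obtains e where "e \<in> edges G" "x \<in> e"
proof -
  obtain p where p: "walk G p" "hd p = x" "last p = y"
    using assms by (auto simp: connected_graph_def)
  then obtain z q where "p = x # z # q"
    using assms(4) by (cases p rule: remdups_adj.cases) (auto simp: walk_def)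
  then show ?thesis using p that[of "{x, z}"] by (auto simp: walk_def)
qed

text \<open>A single covering tree would span the graph in one colour \<open>i\<close>, and having
  at least two vertices it would put an edge of colour \<open>i\<close> at every vertex.\<close>

lemma two_le_tc:
  assumes G: "finite (verts G)" "2 \<le> card (verts G)" and r: "1 \<le> r"
    and avoid: "\<And>i. i \<in> {1..r} \<Longrightarrow> \<exists>x\<in>verts G. \<forall>e\<in>edges G. x \<in> e \<longrightarrow> i \<notin> \<phi> e"
  shows "2 \<le> tc r G \<phi>"
proof (rule ccontr)
  assume "\<not> ?thesis"
  then have less: "tc r G \<phi> < 2" by simp
  obtain \<T> where cov: "mono_tree_cover r G \<phi> \<T>" and card: "card \<T> = tc r G \<phi>"
    using tc_attained[OF G(1) r] by blast
  have fin: "finite \<T>" and un: "(\<Union>T\<in>\<T>. verts T) = verts G"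
    using cov by (auto simp: mono_tree_cover_def)
  have "\<T> \<noteq> {}" using un G(2) by auto
  then have "0 < card \<T>" using fin by (simp add: card_gt_0_iff)
  then have "card \<T> = 1" using card less by linarith
  then obtain T where "\<T> = {T}" by (auto simp: card_1_singleton_iff)
  then have T: "subgraph T G" "connected_graph T" "monochromatic r \<phi> T" "verts T = verts G"
    using cov by (auto simp: mono_tree_cover_def tree_def)
  then obtain i where i: "i \<in> {1..r}" "\<And>e. e \<in> edges T \<Longrightarrow> i \<in> \<phi> e"
    by (auto simp: monochromatic_def)
  obtain x where x: "x \<in> verts G" "\<And>e. e \<in> edges G \<Longrightarrow> x \<in> e \<Longrightarrow> i \<notin> \<phi> e"
    using avoid[OF i(1)] by blast
  obtain y where "y \<in> verts G" "y \<noteq> x"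
  proof -
    have "\<not> verts G \<subseteq> {x}" using G(2) card_mono[of "{x}" "verts G"] by auto
    then show ?thesis using that by blast
  qed
  then obtain e where "e \<in> edges T" "x \<in> e"
    using connected_graph_incident_edge[OF T(2), of x y] x(1) T(4) by metis
  then show False using i(2) x(2) T(1) by (auto simp: subgraph_def)
qed

text \<open>Vertices and colours are both numbers, so an edge can avoid its own ends as colours;
  removing two elements from \<open>{1..4}\<close> leaves at least two.\<close>

lemma vertex_avoiding_colouring:
  obtains \<phi> where "colouring 5 2 (complete_graph n) \<phi>"
    "\<And>e i. e \<in> edges (complete_graph n) \<Longrightarrow> i \<in> \<phi> e \<Longrightarrow> i \<in> {1..4} - e"
proof -
  have "\<exists>C. C \<subseteq> {1..4::nat} - e \<and> card C = 2" if "e \<in> edges (complete_graph n)" for e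
  proof -
    have "card e = 2" using that by (simp add: complete_graph_def)
    then have "2 \<le> card ({1..4} - e)" using diff_card_le_card_Diff[of e "{1..4}"]
      by (simp add: card_ge_0_finite)
    then show ?thesis using obtain_subset_with_card_n by metis
  qed
  then obtain \<phi> where \<phi>: "\<And>e. e \<in> edges (complete_graph n) \<Longrightarrow> \<phi> e \<subseteq> {1..4} - e \<and> card (\<phi> e) = 2"
    by metis
  then have "colouring 5 2 (complete_graph n) \<phi>"
    unfolding colouring_def by fastforce
  with \<phi> that show ?thesis by blast
qed

theorem theorem1p3:
  fixes n :: nat
  assumes "n \<ge> 4"
  shows "tree_cover_number 5 2 (complete_graph n) = 2"
proof (rule antisym)
  \<comment> \<open>Two trees suffice because 5 < 2 + 2 * 2.\<close>
  show "tree_cover_number 5 2 (complete_graph n) \<le> 2"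
    unfolding tree_cover_number_def
    by (rule Least_le) (use tc_complete_graph_le[of 5 2 n _ 2] assms in auto)
  obtain \<phi> where col: "colouring 5 2 (complete_graph n) \<phi>"
    and \<phi>: "\<And>e i. e \<in> edges (complete_graph n) \<Longrightarrow> i \<in> \<phi> e \<Longrightarrow> i \<in> {1..4} - e"
    using vertex_avoiding_colouring[of n] by blast
  have V: "verts (complete_graph n) = {1..n}" by (simp add: complete_graph_def)
  have "2 \<le> tc 5 (complete_graph n) \<phi>"
  proof (rule two_le_tc)
    fix i :: nat assume "i \<in> {1..5}"
    then show "\<exists>x\<in>verts (complete_graph n). \<forall>e\<in>edges (complete_graph n). x \<in> e \<longrightarrow> i \<notin> \<phi> e"
      \<comment> \<open>Colour \<open>i\<close> \<le> 4 is absent at vertex \<open>i\<close>, which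
        exists as \<open>n\<close> \<ge> 4. Colour 5 occurs nowhere, so any vertex would do; 1 is
        taken.\<close>
      using \<phi> assms by (intro bexI[of _ "if i = 5 then 1 else i"]) (fastforce simp: V)+
  qed (use assms V in auto)
  also have "\<dots> \<le> tree_cover_number 5 2 (complete_graph n)"
    using tree_cover_number_attained col V by (metis finite_atLeastAtMost one_le_numeral)
  finally show "2 \<le> tree_cover_number 5 2 (complete_graph n)" .
qed

end
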